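(* For every real number $\epsilon \in (0,1)$ there exists a constant $c_\epsilon > 0$ (depending only on $\epsilon$) such that for every integer $n \ge 2$ and every integer $m \in \left[n, 2^{n^{1-\epsilon}}\right]$ there exists a matrix $A \in \{0,1\}^{m\times n}$ with $$\frac{\mathrm{herdisc}(A)}{\mathrm{detlb}(A)} \ge c_\epsilon \sqrt{\log m \,\log n}.$$
   Context: For a real $m\times n$ matrix $A$, the discrepancy is $\mathrm{disc}(A) = \min_{x\in\{\pm1\}^n}\|Ax\|_\infty$. The hereditary discrepancy $\mathrm{herdisc}(A)$ is the maximum of $\mathrm{disc}(B)$ over all submatrices $B$ of $A$ (equivalently, over all submatrices consisting of a nonempty subset of the columns of $A$). The determinant lower bound is $\mathrm{detlb}(A) = \max_{k}\max_{B}|\det(B)|^{1/k}$, where $k$ ranges over $1\le k\le \min(m,n)$ and $B$ over all $k\times k$ submatrices of $A$ (any $k$ rows and any $k$ columns). *)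

theory Defs
  imports
    Complex_Main
    "Jordan_Normal_Form.Determinant"
    "Jordan_Normal_Form.DL_Submatrix"
begin

text \<open>The maximum norm; inserting \<open>0\<close> only matters for the vector of dimension \<open>0\<close>.\<close>

definition linf_norm :: "real vec \<Rightarrow> real" where
  "linf_norm v = Max (insert 0 {\<bar>v $ i\<bar> | i. i < dim_vec v})"

definition sign_vecs :: "nat \<Rightarrow> real vec set" where
  "sign_vecs n = {x \<in> carrier_vec n. \<forall>i<n. x $ i \<in> {-1, 1}}"

definition disc :: "real mat \<Rightarrow> real" where
  "disc A = Min {linf_norm (A *\<^sub>v x) | x. x \<in> sign_vecs (dim_col A)}"

text \<open>
  Submatrices are given by a set of rows and a set of columns, listed in increasing order. Any
  other order would change neither the discrepancy nor the absolute value of the determinant.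
  The maxima below are over finite nonempty sets as soon as \<open>A\<close> has at least one row and one column.
\<close>

definition herdisc :: "real mat \<Rightarrow> real" where
  "herdisc A = Max {disc (submatrix A I J) | I J.
     I \<subseteq> {..<dim_row A} \<and> I \<noteq> {} \<and> J \<subseteq> {..<dim_col A} \<and> J \<noteq> {}}"

definition detlb :: "real mat \<Rightarrow> real" where
  "detlb A = Max {root k \<bar>det (submatrix A I J)\<bar> | k I J.
     1 \<le> k \<and> k \<le> min (dim_row A) (dim_col A) \<and>
     I \<subseteq> {..<dim_row A} \<and> card I = k \<and> J \<subseteq> {..<dim_col A} \<and> card J = k}"

lemma finite_linf_norm_set: "finite {\<bar>v $ i\<bar> | i. i < dim_vec (v :: real vec)}"
  by simp

lemma finite_sign_vecs: "finite (sign_vecs n)"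
proof -
  have "sign_vecs n \<subseteq> vec_of_list ` {xs. set xs \<subseteq> {-1, 1} \<and> length xs = n}"
  proof
    fix x assume x: "x \<in> sign_vecs n"
    then have "set (list_of_vec x) \<subseteq> {-1, 1}" "length (list_of_vec x) = n"
      by (auto simp: sign_vecs_def in_set_conv_nth list_of_vec_index)
    then show "x \<in> vec_of_list ` {xs. set xs \<subseteq> {-1, 1} \<and> length xs = n}"
      by (intro image_eqI[of _ _ "list_of_vec x"]) (auto simp: vec_list)
  qed
  then show ?thesis
    by (rule finite_subset) (intro finite_imageI finite_lists_length_eq, simp)
qed

lemma sign_vecs_nonempty: "sign_vecs n \<noteq> {}"
proof -
  have "vec n (\<lambda>_. 1) \<in> sign_vecs n" by (auto simp: sign_vecs_def)
  then show ?thesis by blast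
qed

lemma finite_herdisc_set:
  "finite {disc (submatrix A I J) | I J.
     I \<subseteq> {..<dim_row A} \<and> I \<noteq> {} \<and> J \<subseteq> {..<dim_col A} \<and> J \<noteq> {}}"
  by (rule finite_subset[of _ "(\<lambda>(I, J). disc (submatrix A I J)) `
        (Pow {..<dim_row A} \<times> Pow {..<dim_col A})"]) auto

lemma finite_detlb_set:
  "finite {root k \<bar>det (submatrix (A :: real mat) I J)\<bar> | k I J.
     1 \<le> k \<and> k \<le> min (dim_row A) (dim_col A) \<and>
     I \<subseteq> {..<dim_row A} \<and> card I = k \<and> J \<subseteq> {..<dim_col A} \<and> card J = k}"
  by (rule finite_subset[of _ "(\<lambda>(I, J). root (card I) \<bar>det (submatrix A I J)\<bar>) `
        (Pow {..<dim_row A} \<times> Pow {..<dim_col A})"]) auto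

end

theory Submission
  imports Defs "HOL-Library.Nat_Bijection"
begin

text \<open>
  The matrix is the Kronecker product of the incidence matrix of all subsets of \<open>{..<k}\<close> with the
  set system of a binary tree of depth \<open>d\<close>: the columns are the inner nodes \<open>v\<close>, and each leaf \<open>N\<close>
  has one row marking the nodes where the path to \<open>N\<close> turns left, and one for the right turns.
  Here \<open>k\<close> is of order \<open>log m\<close> and \<open>d\<close> of order \<open>log n\<close>.

  Discrepancy: for any signs on the nodes, left turns minus right turns along a uniformly random leaf
  form a simple random walk with \<open>d\<close> steps, whose mean absolute value is at least \<open>sqrt (d / 3)\<close>
  by its second and fourth moments. Some leaf and direction therefore make the absolute row sums,
  added over the \<open>k\<close> copies, of order \<open>k * sqrt d\<close>, and a suitable subset of the copies realizes a
  constant fraction of that sum without cancellation.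

  Determinants: expanding by the direction of the rows costs a factor \<open>2 ^ s\<close> and leaves \<open>s \<times> s\<close>
  matrices whose columns are laminar within each copy. Unimodular column operations make them
  disjoint, so that each row has at most \<open>k\<close> entries \<open>1\<close>, and Hadamard's inequality bounds the
  determinant by \<open>sqrt k ^ s\<close>. Thus \<open>detlb \<le> 2 * sqrt k\<close>.
\<close>

subsection \<open>Hadamard's inequality\<close>

text \<open>A Householder reflection: \<open>Q\<close> reflects in the hyperplane orthogonal to
  \<open>v\<close>, the difference of \<open>r\<close> and \<open>\<rho>\<close> times the first
  unit vector, and so swaps these two vectors of equal norm.\<close>

lemma householder_exists:
  fixes r :: "real vec"
  assumes r: "r \<in> carrier_vec (Suc n)"
  shows "\<exists>Q \<in> carrier_mat (Suc n) (Suc n). Q * transpose_mat Q = 1\<^sub>m (Suc n) \<and>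
    (\<forall>j. 0 < j \<longrightarrow> j \<le> n \<longrightarrow> (\<Sum>k\<le>n. r $ k * Q $$ (k, j)) = 0)"
proof -
  define \<rho> where "\<rho> = sqrt (\<Sum>k\<le>n. (r $ k)\<^sup>2)"
  define v where "v k = r $ k - (if k = 0 then \<rho> else 0)" for k
  define w where "w = (\<Sum>k\<le>n. v k * v k)"
  define t where "t = 2 / w" \<comment> \<open>if \<open>w = 0\<close> then \<open>t = 0\<close>, and the reflection below is the identity\<close>
  define Q where "Q = mat (Suc n) (Suc n) (\<lambda>(i, j). of_bool (i = j) - t * v i * v j)"
  have \<rho>: "\<rho>\<^sup>2 = (\<Sum>k\<le>n. (r $ k)\<^sup>2)"
    unfolding \<rho>_def by (simp add: sum_nonneg)
  have v0: "v k = 0" if "w = 0" "k \<le> n" for k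
    using that sum_nonneg_eq_0_iff[of "{..n}" "\<lambda>k. v k * v k"] by (simp add: w_def)
  have tw: "t * w = 2" if "w \<noteq> 0" using that by (simp add: t_def)
  have rv: "(\<Sum>k\<le>n. r $ k * v k) = \<rho>\<^sup>2 - \<rho> * r $ 0"
  proof -
    have "(\<Sum>k\<le>n. r $ k * v k) = (\<Sum>k\<le>n. (r $ k)\<^sup>2 - (if k = 0 then \<rho> * r $ 0 else 0))"
      by (intro sum.cong) (auto simp: v_def algebra_simps power2_eq_square)
    then show ?thesis by (simp add: sum_subtractf \<rho>)
  qed
  \<comment> \<open>Both vectors have norm \<open>\<rho>\<close>, so the projection of
    \<open>r\<close> on \<open>v\<close> is \<open>v / 2\<close>; this is why reflecting
    \<open>r\<close> subtracts exactly \<open>v\<close>.\<close>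
  have w: "w = 2 * (\<Sum>k\<le>n. r $ k * v k)"
  proof -
    have "w = (\<Sum>k\<le>n. (r $ k)\<^sup>2 + (if k = 0 then \<rho>\<^sup>2 - 2 * \<rho> * r $ 0 else 0))"
      unfolding w_def by (intro sum.cong) (auto simp: v_def algebra_simps power2_eq_square)
    then show ?thesis by (simp add: sum.distrib \<rho>[symmetric] rv)
  qed
  have "Q * transpose_mat Q = 1\<^sub>m (Suc n)"
  proof (rule eq_matI)
    fix i j assume "i < dim_row (1\<^sub>m (Suc n))" "j < dim_col (1\<^sub>m (Suc n))"
    then have i: "i \<le> n" and j: "j \<le> n" by auto
    have "(Q * transpose_mat Q) $$ (i, j) =
        (\<Sum>k\<le>n. (of_bool (i = k) - t * v i * v k) * (of_bool (j = k) - t * v j * v k))"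
      using i j by (simp add: Q_def scalar_prod_def atLeast0LessThan lessThan_Suc_atMost)
    also have "\<dots> = (\<Sum>k\<le>n. of_bool (i = k) * of_bool (j = k)
        - of_bool (i = k) * (t * v j * v k) - of_bool (j = k) * (t * v i * v k)
        + t * t * v i * v j * (v k * v k))"
      by (intro sum.cong) (auto simp: algebra_simps)
    also have "\<dots> = of_bool (i = j) - 2 * t * v i * v j + t * (t * w) * v i * v j"
      using i j by (simp add: sum.distrib sum_subtractf w_def sum_distrib_left algebra_simps of_bool_def
          if_distrib[of "\<lambda>x. _ * x"] if_distrib[of "\<lambda>x. x * _"] cong: if_cong)
    also have "\<dots> = of_bool (i = j)"
      using v0[OF _ i] tw by (cases "w = 0") auto
    finally show "(Q * transpose_mat Q) $$ (i, j) = 1\<^sub>m (Suc n) $$ (i, j)"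
      using i j by simp
  qed (auto simp: Q_def)
  moreover have "(\<Sum>k\<le>n. r $ k * Q $$ (k, j)) = 0" if j: "0 < j" "j \<le> n" for j
  proof -
    have "(\<Sum>k\<le>n. r $ k * Q $$ (k, j)) = (\<Sum>k\<le>n. (if k = j then r $ j else 0) - t * v j * (r $ k * v k))"
      using j by (intro sum.cong) (auto simp: Q_def algebra_simps)
    also have "\<dots> = r $ j - t * v j * (w / 2)"
      using j by (simp add: sum_subtractf sum_distrib_left[symmetric] w)
    also have "\<dots> = v j - t * w / 2 * v j" using j by (simp add: v_def)
    also have "\<dots> = 0" using v0[OF _ j(2)] tw by (cases "w = 0") auto
    finally show ?thesis .
  qed
  ultimately show ?thesis by (intro bexI[of _ Q]) (auto simp: Q_def)
qed

text \<open>Multiplying by a reflection from the right clears row 0 beyond its first entry and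
  preserves row norms and the squared determinant. Laplace expansion then leaves a minor whose rows
  have only lost an entry.\<close>

lemma hadamard_inequality:
  fixes M :: "real mat"
  assumes "M \<in> carrier_mat n n"
  shows "(det M)\<^sup>2 \<le> (\<Prod>i<n. \<Sum>j<n. (M $$ (i, j))\<^sup>2)"
  using assms
proof (induction n arbitrary: M)
  case 0
  then show ?case by (simp add: det_def)
next
  case (Suc n)
  note M = Suc.prems
  obtain Q where Q: "Q \<in> carrier_mat (Suc n) (Suc n)" "Q * transpose_mat Q = 1\<^sub>m (Suc n)"
    and Q0: "\<And>j. 0 < j \<Longrightarrow> j \<le> n \<Longrightarrow> (\<Sum>k\<le>n. row M 0 $ k * Q $$ (k, j)) = 0"
    using householder_exists[OF row_carrier_vec[OF zero_less_Suc M]] by blast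
  define N where "N = M * Q"
  have N: "N \<in> carrier_mat (Suc n) (Suc n)" using M Q by (simp add: N_def)
  define D where "D = mat_delete N 0 0"
  have D: "D \<in> carrier_mat n n" using mat_delete_carrier[OF N] by (simp add: D_def)
  have "det Q * det Q = 1"
    using det_mult[of Q "Suc n" "transpose_mat Q"] Q det_transpose[OF Q(1)] by simp
  then have detN: "(det N)\<^sup>2 = (det M)\<^sup>2"
    using det_mult[OF M Q(1)] by (simp add: N_def power2_eq_square algebra_simps)
  have N0: "N $$ (0, j) = 0" if "0 < j" "j \<le> n" for j
    using that M Q Q0[OF that] by (simp add: N_def scalar_prod_def atLeast0LessThan lessThan_Suc_atMost)
  \<comment> \<open>Squared row norms are the diagonal entries of the Gram matrix, which an
    orthogonal factor does not change.\<close>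
  have norm: "(\<Sum>j<Suc n. (N $$ (i, j))\<^sup>2) = (\<Sum>j<Suc n. (M $$ (i, j))\<^sup>2)" if "i < Suc n" for i
  proof -
    have "N * transpose_mat N = M * (Q * transpose_mat Q) * transpose_mat M"
      using M Q(1) by (simp add: N_def transpose_mult assoc_mult_mat[of _ "Suc n" "Suc n" _ "Suc n" _ "Suc n"])
    then have "N * transpose_mat N = M * transpose_mat M" using M Q(2) by simp
    then have "(N * transpose_mat N) $$ (i, i) = (M * transpose_mat M) $$ (i, i)" by simp
    then show ?thesis using that M N
      by (simp add: scalar_prod_def power2_eq_square atLeast0LessThan del: sum.lessThan_Suc)
  qed
  have "det N = (\<Sum>j<Suc n. N $$ (0, j) * cofactor N 0 j)"
    using laplace_expansion_row[OF N, of 0] by simp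
  also have "\<dots> = N $$ (0, 0) * det D"
    using N0 by (simp add: sum.lessThan_Suc_shift D_def cofactor_def del: sum.lessThan_Suc)
  finally have "(det N)\<^sup>2 = (N $$ (0, 0))\<^sup>2 * (det D)\<^sup>2" by (simp add: power_mult_distrib)
  also have "\<dots> \<le> (\<Sum>j<Suc n. (N $$ (0, j))\<^sup>2) * (\<Prod>i<n. \<Sum>j<Suc n. (N $$ (Suc i, j))\<^sup>2)"
  proof (intro mult_mono)
    show "(N $$ (0, 0))\<^sup>2 \<le> (\<Sum>j<Suc n. (N $$ (0, j))\<^sup>2)"
      by (rule member_le_sum) auto
    have "(det D)\<^sup>2 \<le> (\<Prod>i<n. \<Sum>j<n. (D $$ (i, j))\<^sup>2)" by (rule Suc.IH[OF D])
    also have "\<dots> \<le> (\<Prod>i<n. \<Sum>j<Suc n. (N $$ (Suc i, j))\<^sup>2)"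
    proof (intro prod_mono conjI)
      fix i assume "i \<in> {..<n}"
      then have "(\<Sum>j<n. (D $$ (i, j))\<^sup>2) = (\<Sum>j<n. (N $$ (Suc i, Suc j))\<^sup>2)"
        using N by (intro sum.cong) (auto simp: D_def mat_delete_def)
      then show "(\<Sum>j<n. (D $$ (i, j))\<^sup>2) \<le> (\<Sum>j<Suc n. (N $$ (Suc i, j))\<^sup>2)"
        by (simp add: sum.lessThan_Suc_shift del: sum.lessThan_Suc)
    qed (simp add: sum_nonneg)
    finally show "(det D)\<^sup>2 \<le> (\<Prod>i<n. \<Sum>j<Suc n. (N $$ (Suc i, j))\<^sup>2)" .
  qed (auto simp: sum_nonneg prod_nonneg)
  also have "\<dots> = (\<Prod>i<Suc n. \<Sum>j<Suc n. (N $$ (i, j))\<^sup>2)"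
    by (simp only: prod.lessThan_Suc_shift)
  also have "\<dots> = (\<Prod>i<Suc n. \<Sum>j<Suc n. (M $$ (i, j))\<^sup>2)"
    by (intro prod.cong refl norm) simp
  finally show ?case by (simp add: detN)
qed

subsection \<open>Determinants of laminar matrices\<close>

text \<open>
  If \<open>V a \<subset> V b\<close> for two columns with the same label, subtracting column \<open>a\<close> from column \<open>b\<close> replaces
  \<open>V b\<close> by \<open>V b - V a\<close>. Choosing \<open>card (V b - V a)\<close> minimal leaves no set strictly in between, so
  laminarity survives. When this is no longer possible, every row has at most \<open>k\<close> ones.
\<close>

lemma det_laminar_finite:
  fixes V :: "nat \<Rightarrow> 'a set" and q :: "nat \<Rightarrow> 'a" and S :: "nat \<Rightarrow> 'b set" and l :: "nat \<Rightarrow> 'b"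
  assumes S: "\<And>r. r < s \<Longrightarrow> finite (S r) \<and> card (S r) \<le> k"
    and "\<And>c. c < s \<Longrightarrow> finite (V c)"
    and "\<And>c c'. c < s \<Longrightarrow> c' < s \<Longrightarrow> l c = l c' \<Longrightarrow>
      V c \<subseteq> V c' \<or> V c' \<subseteq> V c \<or> V c \<inter> V c' = {}"
  shows "(det (mat s s (\<lambda>(r, c). of_bool (l c \<in> S r \<and> q r \<in> V c) :: real)))\<^sup>2 \<le> real k ^ s"
  using assms(2,3)
proof (induction "\<Sum>c<s. card (V c)" arbitrary: V rule: less_induct)
  case less
  note fin = less.prems(1) and lam = less.prems(2)
  let ?M = "\<lambda>V. mat s s (\<lambda>(r, c). of_bool (l c \<in> S r \<and> q r \<in> V c) :: real)"
  \<comment> \<open>Equal sets count as nested: subtraction then empties column \<open>b\<close>.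
    Since \<open>V a\<close> is nonempty, the total cardinality, on which the induction runs,
    drops.\<close>
  define P where "P = (\<lambda>(a, b). a < s \<and> b < s \<and> a \<noteq> b \<and> l a = l b \<and> V a \<subseteq> V b \<and> V a \<noteq> {})"
  show ?case
  proof (cases "\<exists>x. P x")
    case False
    have disj: "V a \<inter> V b = {}" if ab: "a < s" "b < s" "a \<noteq> b" "l a = l b" for a b
    proof (rule ccontr)
      assume ne: "V a \<inter> V b \<noteq> {}"
      have "V a \<subseteq> V b \<or> V b \<subseteq> V a" using lam[OF ab(1,2,4)] ne by blast
      then consider "V a \<subseteq> V b" | "V b \<subseteq> V a" by blast
      then show False
      proof cases
        case 1
        then have "P (a, b)" using ab ne by (auto simp: P_def)
        then show ?thesis using False by blast
      next
        case 2
        then have "P (b, a)" using ab ne by (auto simp: P_def)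
        then show ?thesis using False by blast
      qed
    qed
    have "(det (?M V))\<^sup>2 \<le> (\<Prod>r<s. \<Sum>c<s. (?M V $$ (r, c))\<^sup>2)"
      by (rule hadamard_inequality) simp
    also have "\<dots> \<le> (\<Prod>r<s. real k)"
    proof (intro prod_mono conjI)
      fix r assume "r \<in> {..<s}"
      then have r: "r < s" by simp
      have "(\<Sum>c<s. (?M V $$ (r, c))\<^sup>2) = (\<Sum>c<s. of_bool (l c \<in> S r \<and> q r \<in> V c))"
        using r by (intro sum.cong) auto
      also have "\<dots> = real (card {c\<in>{..<s}. l c \<in> S r \<and> q r \<in> V c})"
        by (simp add: of_bool_def flip: sum.inter_filter)
      \<comment> \<open>Two columns with a 1 in row \<open>r\<close> share the point
        \<open>q r\<close>, so disjointness forces their labels to differ.\<close>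
      also have "card {c\<in>{..<s}. l c \<in> S r \<and> q r \<in> V c} \<le> card (S r)"
      proof (rule card_inj_on_le[where f = l])
        show "inj_on l {c\<in>{..<s}. l c \<in> S r \<and> q r \<in> V c}"
          using disj by (intro inj_onI) blast
      qed (use S[OF r] in auto)
      also have "\<dots> \<le> k" using S[OF r] by simp
      finally show "(\<Sum>c<s. (?M V $$ (r, c))\<^sup>2) \<le> real k" by simp
    qed (simp add: sum_nonneg)
    finally show ?thesis by simp
  next
    case True
    then obtain x where x: "P x"
        "\<And>y. P y \<Longrightarrow> card (V (snd x) - V (fst x)) \<le> card (V (snd y) - V (fst y))"
      using ex_has_least_nat[of P _ "\<lambda>x. card (V (snd x) - V (fst x))"] by metis
    obtain a b where x_eq: "x = (a, b)" by fastforce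
    then have ab: "a < s" "b < s" "a \<noteq> b" "l a = l b" "V a \<subseteq> V b" "V a \<noteq> {}"
      using x(1) by (auto simp: P_def)
    have min: "card (V b - V a) \<le> card (V b - V c)" if "P (c, b)" for c
      using x(2)[OF that] by (simp add: x_eq)
    define V' where "V' = V(b := V b - V a)"
    have "?M V' = addcol (-1) b a (?M V)"
      using ab by (intro eq_matI) (auto simp: V'_def)
    then have det: "det (?M V') = det (?M V)"
      using ab by (simp add: det_addcol[of a s b])
    have between: "V c = V a" if "c < s" "c \<noteq> b" "l c = l b" "V a \<subseteq> V c" "V c \<subseteq> V b" for c
    proof (rule ccontr)
      assume "V c \<noteq> V a"
      then have "V b - V c \<subset> V b - V a" using that by blast
      then have "card (V b - V c) < card (V b - V a)"
        using fin ab by (intro psubset_card_mono) auto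
      moreover have "P (c, b)" using that ab by (auto simp: P_def)
      ultimately show False using min by force
    qed
    \<comment> \<open>Only a set strictly between \<open>V a\<close> and \<open>V b\<close> could
      cut across their difference, and \<open>between\<close> excludes it.\<close>
    have diff: "V c \<subseteq> V b - V a \<or> V b - V a \<subseteq> V c \<or> V c \<inter> (V b - V a) = {}"
      if "c < s" "c \<noteq> b" "l c = l b" for c
    proof (cases "V a \<subseteq> V c \<and> V c \<subseteq> V b")
      case True
      then show ?thesis using between[of c] that by blast
    next
      case False
      have b: "V c \<subseteq> V b \<or> V b \<subseteq> V c \<or> V c \<inter> V b = {}"
        using lam[OF that(1) ab(2) that(3)] .
      have "V c \<subseteq> V a \<or> V a \<subseteq> V c \<or> V c \<inter> V a = {}"
        using lam[OF that(1) ab(1)] that(3) ab(4) by simp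
      then consider "V b \<subseteq> V c" | "V c \<inter> V b = {}" | "V c \<subseteq> V a" | "V c \<subseteq> V b" "V c \<inter> V a = {}"
        using b False by argo
      then show ?thesis by cases auto
    qed
    have "(\<Sum>c<s. card (V' c)) < (\<Sum>c<s. card (V c))"
    proof (rule sum_strict_mono_ex1)
      show "\<forall>c\<in>{..<s}. card (V' c) \<le> card (V c)"
        using fin by (auto simp: V'_def intro!: card_mono)
      have "V b - V a \<subset> V b" using ab by blast
      then show "\<exists>c\<in>{..<s}. card (V' c) < card (V c)"
        using fin ab by (intro bexI[of _ b]) (auto simp: V'_def intro!: psubset_card_mono)
    qed simp
    moreover have "finite (V' c)" if "c < s" for c
      using fin that ab by (auto simp: V'_def)
    moreover have "V' c \<subseteq> V' c' \<or> V' c' \<subseteq> V' c \<or> V' c \<inter> V' c' = {}"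
      if c: "c < s" "c' < s" "l c = l c'" for c c'
      using lam[OF c] diff[of c] diff[of c'] c unfolding V'_def by auto
    ultimately have "(det (?M V'))\<^sup>2 \<le> real k ^ s" by (rule less.hyps)
    then show ?thesis by (simp only: det)
  qed
qed

text \<open>Only the finitely many points \<open>q r\<close> are ever tested, and intersecting with
  them keeps the family laminar.\<close>

lemma det_laminar_le:
  fixes V :: "nat \<Rightarrow> 'a set" and q :: "nat \<Rightarrow> 'a" and S :: "nat \<Rightarrow> 'b set" and l :: "nat \<Rightarrow> 'b"
  assumes S: "\<And>r. r < s \<Longrightarrow> finite (S r) \<and> card (S r) \<le> k"
    and lam: "\<And>c c'. c < s \<Longrightarrow> c' < s \<Longrightarrow> l c = l c' \<Longrightarrow>
      V c \<subseteq> V c' \<or> V c' \<subseteq> V c \<or> V c \<inter> V c' = {}"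
  shows "\<bar>det (mat s s (\<lambda>(r, c). of_bool (l c \<in> S r \<and> q r \<in> V c) :: real))\<bar> \<le> sqrt (real k) ^ s"
proof -
  let ?V = "\<lambda>c. V c \<inter> q ` {..<s}"
  have "mat s s (\<lambda>(r, c). of_bool (l c \<in> S r \<and> q r \<in> V c)) =
      mat s s (\<lambda>(r, c). of_bool (l c \<in> S r \<and> q r \<in> ?V c) :: real)"
    by (intro eq_matI) auto
  moreover have "(det (mat s s (\<lambda>(r, c). of_bool (l c \<in> S r \<and> q r \<in> ?V c) :: real)))\<^sup>2 \<le> real k ^ s"
  proof (rule det_laminar_finite[OF S])
    fix c c' assume "c < s" "c' < s" "l c = l c'"
    from lam[OF this] show "?V c \<subseteq> ?V c' \<or> ?V c' \<subseteq> ?V c \<or> ?V c \<inter> ?V c' = {}" by blast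
  qed auto
  ultimately have "\<bar>det (mat s s (\<lambda>(r, c). of_bool (l c \<in> S r \<and> q r \<in> V c) :: real))\<bar> \<le> sqrt (real k ^ s)"
    by (intro real_le_rsqrt) simp
  then show ?thesis by (simp add: real_sqrt_power)
qed

text \<open>
  Laplace expansion along a set of rows, grouped by the set \<open>K\<close> of columns that a permutation
  assigns to the rows with \<open>R\<close>; no signs or orderings of minors are needed in this form.
\<close>

lemma det_split_columns:
  fixes M :: "'a :: comm_ring_1 mat"
  assumes M: "M \<in> carrier_mat s s"
  shows "det M = (\<Sum>K\<in>Pow {0..<s}.
    det (mat s s (\<lambda>(r, c). if R r = (c \<in> K) then M $$ (r, c) else 0)))"
proof -
  let ?f = "\<lambda>K r c. if R r = (c \<in> K) then M $$ (r, c) else 0"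
  let ?\<Pi> = "{p. p permutes {0..<s}}"
  have one: "(\<Sum>K\<in>Pow {0..<s}. \<Prod>r = 0..<s. ?f K r (p r)) = (\<Prod>r = 0..<s. M $$ (r, p r))"
    if p: "p permutes {0..<s}" for p
  proof -
    \<comment> \<open>For a given permutation this is the only \<open>K\<close> whose product does
      not contain a forced zero.\<close>
    let ?K = "p ` {r\<in>{0..<s}. R r}"
    have K: "?K \<subseteq> {0..<s}" using permutes_image[OF p] by blast
    have "(\<Prod>r = 0..<s. ?f K r (p r)) = (if ?K = K then \<Prod>r = 0..<s. M $$ (r, p r) else 0)"
      if "K \<in> Pow {0..<s}" for K
    proof (cases "?K = K")
      case True
      then have "R r = (p r \<in> K)" if "r < s" for r
        using permutes_inj[OF p] that by (auto simp: inj_def)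
      then show ?thesis using True by (auto intro!: prod.cong)
    next
      case False
      have "\<exists>r<s. R r \<noteq> (p r \<in> K)"
      proof (rule ccontr)
        assume "\<not> ?thesis"
        then have "?K = p ` {r\<in>{0..<s}. p r \<in> K}" by (auto intro!: image_eqI)
        also have "\<dots> = p ` {0..<s} \<inter> K" by blast
        also have "\<dots> = K" using permutes_image[OF p] that by blast
        finally show False using False by simp
      qed
      then show ?thesis using False by (auto intro!: prod_zero)
    qed
    then have "(\<Sum>K\<in>Pow {0..<s}. \<Prod>r = 0..<s. ?f K r (p r)) =
        (\<Sum>K\<in>Pow {0..<s}. if ?K = K then \<Prod>r = 0..<s. M $$ (r, p r) else 0)"
      by (rule sum.cong[OF refl])
    also have "\<dots> = (\<Prod>r = 0..<s. M $$ (r, p r))"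
      using K by (subst sum.delta') auto
    finally show ?thesis .
  qed
  have "(\<Sum>K\<in>Pow {0..<s}. det (mat s s (\<lambda>(r, c). ?f K r c))) =
      (\<Sum>K\<in>Pow {0..<s}. \<Sum>p\<in>?\<Pi>. signof p * (\<Prod>r = 0..<s. ?f K r (p r)))"
  proof (rule sum.cong[OF refl])
    fix K
    have "det (mat s s (\<lambda>(r, c). ?f K r c)) =
        (\<Sum>p\<in>?\<Pi>. signof p * (\<Prod>r = 0..<s. mat s s (\<lambda>(r, c). ?f K r c) $$ (r, p r)))"
      by (rule det_def') simp
    also have "\<dots> = (\<Sum>p\<in>?\<Pi>. signof p * (\<Prod>r = 0..<s. ?f K r (p r)))"
      by (intro sum.cong prod.cong arg_cong2[where f = "(*)"] refl)
        (auto dest: permutes_in_image)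
    finally show "det (mat s s (\<lambda>(r, c). ?f K r c)) =
        (\<Sum>p\<in>?\<Pi>. signof p * (\<Prod>r = 0..<s. ?f K r (p r)))" .
  qed
  also have "\<dots> = (\<Sum>p\<in>?\<Pi>. signof p * (\<Sum>K\<in>Pow {0..<s}. \<Prod>r = 0..<s. ?f K r (p r)))"
    by (subst sum.swap) (simp only: sum_distrib_left)
  also have "\<dots> = (\<Sum>p\<in>?\<Pi>. signof p * (\<Prod>r = 0..<s. M $$ (r, p r)))"
    by (intro sum.cong) (simp_all only: one mem_Collect_eq)
  also have "\<dots> = det M" by (rule det_def'[OF M, symmetric])
  finally show ?thesis by simp
qed

text \<open>Once \<open>K\<close> is fixed, each column meets only rows of one direction. Tagging
  its set with that direction merges the two families into one laminar family, because sets with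
  different tags are disjoint. Summing over the \<open>2 ^ s\<close> choices of \<open>K\<close>
  gives the factor 2 inside the power.\<close>

lemma det_two_laminar_le:
  fixes V :: "bool \<Rightarrow> nat \<Rightarrow> 'a set" and q :: "nat \<Rightarrow> 'a"
    and S :: "nat \<Rightarrow> 'b set" and l :: "nat \<Rightarrow> 'b" and \<beta> :: "nat \<Rightarrow> bool"
  assumes S: "\<And>r. r < s \<Longrightarrow> finite (S r) \<and> card (S r) \<le> k"
    and lam: "\<And>b c c'. c < s \<Longrightarrow> c' < s \<Longrightarrow> l c = l c' \<Longrightarrow>
      V b c \<subseteq> V b c' \<or> V b c' \<subseteq> V b c \<or> V b c \<inter> V b c' = {}"
  shows "\<bar>det (mat s s (\<lambda>(r, c). of_bool (l c \<in> S r \<and> q r \<in> V (\<beta> r) c) :: real))\<bar>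
    \<le> (2 * sqrt (real k)) ^ s"
proof -
  let ?M = "mat s s (\<lambda>(r, c). of_bool (l c \<in> S r \<and> q r \<in> V (\<beta> r) c) :: real)"
  let ?N = "\<lambda>K. mat s s (\<lambda>(r, c). if \<beta> r = (c \<in> K) then ?M $$ (r, c) else 0)"
  have *: "\<bar>det (?N K)\<bar> \<le> sqrt (real k) ^ s" for K
  proof -
    let ?V = "\<lambda>c. {c \<in> K} \<times> V (c \<in> K) c"
    have "?N K = mat s s (\<lambda>(r, c). of_bool (l c \<in> S r \<and> (\<beta> r, q r) \<in> ?V c))"
      by (intro eq_matI) auto
    moreover have "\<bar>det (mat s s (\<lambda>(r, c). of_bool (l c \<in> S r \<and> (\<beta> r, q r) \<in> ?V c) :: real))\<bar>
        \<le> sqrt (real k) ^ s"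
    proof (rule det_laminar_le[OF S])
      fix c c' assume c: "c < s" "c' < s" "l c = l c'"
      show "?V c \<subseteq> ?V c' \<or> ?V c' \<subseteq> ?V c \<or> ?V c \<inter> ?V c' = {}"
        using lam[OF c, of True] lam[OF c, of False] by (cases "c \<in> K"; cases "c' \<in> K") auto
    qed auto
    ultimately show ?thesis by simp
  qed
  have "\<bar>det ?M\<bar> = \<bar>\<Sum>K\<in>Pow {0..<s}. det (?N K)\<bar>"
    by (subst det_split_columns[where R = \<beta>]) (rule mat_carrier, rule refl)
  also have "\<dots> \<le> (\<Sum>K\<in>Pow {0..<s}. \<bar>det (?N K)\<bar>)" by (rule sum_abs)
  also have "\<dots> \<le> (\<Sum>K\<in>Pow {0..<s}. sqrt (real k) ^ s)" by (intro sum_mono *)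
  also have "\<dots> = (2 * sqrt (real k)) ^ s" by (simp add: card_Pow power_mult_distrib)
  finally show ?thesis .
qed

subsection \<open>Random walks on the binary tree\<close>

text \<open>
  Nodes of the binary tree are numbered as in a heap: the children of \<open>v\<close> are \<open>2 * v\<close> and
  \<open>2 * v + 1\<close>, the root is \<open>1\<close>, and level \<open>d\<close> is \<open>{2 ^ d..<2 ^ Suc d}\<close>. The number \<open>0\<close> is not a
  node, but counts as an ancestor of everything.
\<close>

definition ancestor :: "nat \<Rightarrow> nat \<Rightarrow> bool" where
  "ancestor w N \<longleftrightarrow> (\<exists>t. N div 2 ^ t = w)"

lemma ancestor_0: "ancestor 0 N"
  unfolding ancestor_def by (rule exI[of _ N]) (simp add: div_less)

lemma ancestor_trans: "ancestor u v \<Longrightarrow> ancestor v w \<Longrightarrow> ancestor u w"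
  unfolding ancestor_def by (metis div_mult2_eq power_add)

lemma ancestor_linear: "ancestor u N \<Longrightarrow> ancestor v N \<Longrightarrow> ancestor u v \<or> ancestor v u"
proof -
  have "ancestor (N div 2 ^ t') (N div 2 ^ t)" if "t \<le> t'" for t t'
    unfolding ancestor_def using that
    by (intro exI[of _ "t' - t"]) (simp add: div_mult2_eq[symmetric] power_add[symmetric])
  then show "ancestor u N \<Longrightarrow> ancestor v N \<Longrightarrow> ancestor u v \<or> ancestor v u"
    unfolding ancestor_def by (metis nat_le_linear)
qed

text \<open>Subtrees with a common node have comparable roots, since the ancestors of a node form a
  chain.\<close>

lemma laminar_ancestor:
  "{N. ancestor u N} \<subseteq> {N. ancestor v N} \<or> {N. ancestor v N} \<subseteq> {N. ancestor u N} \<or>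
    {N. ancestor u N} \<inter> {N. ancestor v N} = {}"
  using ancestor_linear ancestor_trans by blast

lemma ancestor_le: "ancestor u N \<Longrightarrow> u \<le> N"
  by (auto simp: ancestor_def)

lemma ancestor_child:
  assumes "b < 2"
  shows "ancestor u (2 * N + b) \<longleftrightarrow> u = 2 * N + b \<or> ancestor u N"
proof
  assume "ancestor u (2 * N + b)"
  then obtain t where t: "(2 * N + b) div 2 ^ t = u" by (auto simp: ancestor_def)
  show "u = 2 * N + b \<or> ancestor u N"
  proof (cases t)
    case 0
    then show ?thesis using t by simp
  next
    case (Suc t')
    have "(2 * N + b) div 2 = N" using assms by simp
    then have "N div 2 ^ t' = u" using t Suc by (simp add: div_mult2_eq)
    then show ?thesis by (auto simp: ancestor_def)
  qed
next
  have "ancestor N (2 * N + b)"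
    unfolding ancestor_def using assms by (intro exI[of _ 1]) simp
  moreover have "ancestor (2 * N + b) (2 * N + b)" unfolding ancestor_def by (intro exI[of _ 0]) simp
  ultimately show "u = 2 * N + b \<or> ancestor u N \<Longrightarrow> ancestor u (2 * N + b)" using ancestor_trans by blast
qed

text \<open>
  The sum of the values on the path from the root to the leaf \<open>N\<close>, with sign \<open>+\<close> where the path
  turns left and \<open>-\<close> where it turns right. The term \<open>v = 0\<close> vanishes, because \<open>0\<close> and \<open>1\<close> are both
  ancestors of every leaf.
\<close>

definition walk :: "(nat \<Rightarrow> real) \<Rightarrow> nat \<Rightarrow> nat \<Rightarrow> real" where
  "walk x d N = (\<Sum>v<2 ^ d. (of_bool (ancestor (2 * v) N) - of_bool (ancestor (2 * v + 1) N)) * x v)"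

lemma walk_0: "walk x 0 1 = 0"
proof -
  have "ancestor 1 1" unfolding ancestor_def by (intro exI[of _ 0]) simp
  then show ?thesis by (simp add: walk_def ancestor_0)
qed

lemma walk_Suc:
  assumes N: "N \<in> {2 ^ d..<2 ^ Suc d}" and b: "b < 2"
  shows "walk x (Suc d) (2 * N + b) = walk x d N + (if b = 0 then x N else - x N)"
proof -
  let ?f = "\<lambda>N v. (of_bool (ancestor (2 * v) N) - of_bool (ancestor (2 * v + 1) N)) * x v"
  have ancestor: "ancestor (2 * v + c) (2 * N + b) \<longleftrightarrow> v = N \<and> c = b \<or> ancestor (2 * v + c) N"
    if "c < 2" for v c
  proof -
    have "2 * v + c = 2 * N + b \<longleftrightarrow> v = N \<and> c = b" using that b by presburger
    then show ?thesis by (simp only: ancestor_child[OF b])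
  qed
  have low: "?f (2 * N + b) v = ?f N v" if "v < 2 ^ d" for v
    using ancestor[of 0 v] ancestor[of 1 v] N that by auto
  have high: "?f (2 * N + b) v = (if v = N then (if b = 0 then x N else - x N) else 0)"
    if "v \<in> {2 ^ d..<2 ^ Suc d}" for v
  proof -
    \<comment> \<open>Ancestors have numbers at most \<open>N\<close>, while
      \<open>2 * v + c\<close> is already at least \<open>2 ^ Suc d\<close>.\<close>
    have "\<not> ancestor (2 * v + c) N" for c
      using ancestor_le[of "2 * v + c" N] that N by auto
    from this[of 0] this[of 1] show ?thesis
      using ancestor[of 0 v] ancestor[of 1 v] b by auto
  qed
  have split: "{..<2 ^ Suc d} = {..<2 ^ d} \<union> {2 ^ d..<(2::nat) ^ Suc d}"
    by (rule ivl_disj_un_one(2)[symmetric]) simp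
  have "walk x (Suc d) (2 * N + b) =
      (\<Sum>v<2 ^ d. ?f (2 * N + b) v) + (\<Sum>v = 2 ^ d..<2 ^ Suc d. ?f (2 * N + b) v)"
    unfolding walk_def split by (rule sum.union_disjoint) auto
  also have "(\<Sum>v<2 ^ d. ?f (2 * N + b) v) = walk x d N"
    unfolding walk_def using low by (intro sum.cong) auto
  also have "(\<Sum>v = 2 ^ d..<2 ^ Suc d. ?f (2 * N + b) v) =
      (\<Sum>v = 2 ^ d..<2 ^ Suc d. if v = N then (if b = 0 then x N else - x N) else 0)"
    using high by (intro sum.cong) auto
  also have "\<dots> = (if b = 0 then x N else - x N)" using N by (subst sum.delta) auto
  finally show ?thesis .
qed

lemma sum_double_interval:
  fixes g :: "nat \<Rightarrow> 'a :: comm_monoid_add"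
  assumes "a \<le> b"
  shows "(\<Sum>i = 2 * a..<2 * b. g i) = (\<Sum>i = a..<b. g (2 * i) + g (2 * i + 1))"
  using assms by (induction b rule: dec_induct) (simp_all add: add.assoc)

text \<open>Whatever the sign at a node, its two children receive the parent's value plus 1 and
  minus 1 in some order. The distribution over the leaves is thus that of a simple random walk,
  independent of \<open>x\<close>.\<close>

lemma walk_moments:
  assumes x: "\<And>v. v < 2 ^ d \<Longrightarrow> x v \<in> {-1, 1}"
  shows "(\<Sum>N = 2 ^ d..<2 ^ Suc d. (walk x d N) ^ 2) = 2 ^ d * real d"
    and "(\<Sum>N = 2 ^ d..<2 ^ Suc d. (walk x d N) ^ 4) = 2 ^ d * (3 * real d ^ 2 - 2 * real d)"
  using x
proof (induction d)
  case 0
  have *: "{Suc 0..<2} = {Suc 0}" by auto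
  { case 1 show ?case by (simp add: walk_0[simplified] *) }
  { case 2 show ?case by (simp add: walk_0[simplified] *) }
next
  case (Suc d)
  have step: "(\<Sum>N = 2 ^ Suc d..<2 ^ Suc (Suc d). f (walk x (Suc d) N)) =
      (\<Sum>N = 2 ^ d..<2 ^ Suc d. f (walk x d N + 1) + f (walk x d N - 1))"
    if "\<And>v. v < 2 ^ Suc d \<Longrightarrow> x v \<in> {-1, 1}" for f :: "real \<Rightarrow> real"
  proof -
    have "(\<Sum>N = 2 ^ Suc d..<2 ^ Suc (Suc d). f (walk x (Suc d) N)) =
        (\<Sum>N = 2 ^ d..<2 ^ Suc d. f (walk x (Suc d) (2 * N)) + f (walk x (Suc d) (2 * N + 1)))"
      using sum_double_interval[of "2 ^ d" "2 ^ Suc d"] by simp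
    also have "\<dots> = (\<Sum>N = 2 ^ d..<2 ^ Suc d. f (walk x d N + 1) + f (walk x d N - 1))"
    proof (rule sum.cong[OF refl])
      fix N assume N: "N \<in> {2 ^ d..<(2::nat) ^ Suc d}"
      then have "x N = -1 \<or> x N = 1" using that by force
      then show "f (walk x (Suc d) (2 * N)) + f (walk x (Suc d) (2 * N + 1)) =
          f (walk x d N + 1) + f (walk x d N - 1)"
        using walk_Suc[OF N, of 0 x] walk_Suc[OF N, of 1 x] by auto
    qed
    finally show ?thesis .
  qed
  have small: "\<And>v. v < 2 ^ d \<Longrightarrow> x v \<in> {-1, 1}" if "\<And>v. v < 2 ^ Suc d \<Longrightarrow> x v \<in> {-1, 1}"
    using that by simp
  { case 1
    have "(\<Sum>N = 2 ^ Suc d..<2 ^ Suc (Suc d). (walk x (Suc d) N) ^ 2) =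
        (\<Sum>N = 2 ^ d..<2 ^ Suc d. 2 * (walk x d N) ^ 2 + 2)"
      by (subst step[OF 1]) (auto intro!: sum.cong simp: power2_eq_square algebra_simps)
    also have "\<dots> = 2 * (2 ^ d * real d) + 2 * 2 ^ d"
      using Suc.IH(1)[OF small[OF 1]] by (simp add: sum.distrib sum_distrib_left[symmetric])
    finally show ?case by (simp add: algebra_simps) }
  { case 2
    have "(\<Sum>N = 2 ^ Suc d..<2 ^ Suc (Suc d). (walk x (Suc d) N) ^ 4) =
        (\<Sum>N = 2 ^ d..<2 ^ Suc d. 2 * (walk x d N) ^ 4 + 12 * (walk x d N) ^ 2 + 2)"
      by (subst step[OF 2]) (auto intro!: sum.cong simp: power4_eq_xxxx power2_eq_square algebra_simps)
    also have "\<dots> = 2 * (2 ^ d * (3 * real d ^ 2 - 2 * real d)) + 12 * (2 ^ d * real d) + 2 * 2 ^ d"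
      using Suc.IH[OF small[OF 2]] by (simp add: sum.distrib sum_distrib_left[symmetric])
    finally show ?case by (simp add: algebra_simps power2_eq_square) }
qed

text \<open>Bounds the absolute value below by even powers, so that second and fourth moments
  control the mean. Equality holds at \<open>\<bar>s\<bar> = a\<close>, the double root of the
  quartic in the proof.\<close>

lemma abs_ge_quartic:
  fixes a s :: real
  assumes "a > 0"
  shows "\<bar>s\<bar> \<ge> (3 * s\<^sup>2 / a - s ^ 4 / a ^ 3) / 2"
proof -
  define u where "u = \<bar>s\<bar> / a"
  have "u \<ge> 0" using assms by (simp add: u_def)
  then have "0 \<le> u * (u - 1)\<^sup>2 * (u + 2)" by simp
  also have "\<dots> = 2 * u - 3 * u\<^sup>2 + u ^ 4"
    by (simp add: power2_eq_square power4_eq_xxxx algebra_simps)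
  finally have "0 \<le> a * (2 * u - 3 * u\<^sup>2 + u ^ 4)" using assms by simp
  also have "\<dots> = 2 * \<bar>s\<bar> - (3 * s\<^sup>2 / a - s ^ 4 / a ^ 3)"
    using assms by (simp add: u_def power2_eq_square power3_eq_cube power4_eq_xxxx field_simps)
  finally show ?thesis by simp
qed

lemma walk_abs_ge:
  assumes x: "\<And>v. v < 2 ^ d \<Longrightarrow> x v \<in> {-1, 1}"
  shows "(\<Sum>N = 2 ^ d..<2 ^ Suc d. \<bar>walk x d N\<bar>) \<ge> 2 ^ d * sqrt (real d / 3)"
proof (cases "d = 0")
  case False
  \<comment> \<open>With the fourth moment rounded up to \<open>3 * d ^ 2\<close>, this
    \<open>a\<close> maximizes the resulting bound, whose value is
    \<open>(a - a / 3) / 2 = a / 3 = sqrt (d / 3)\<close>.\<close>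
  define a where "a = sqrt (3 * real d)"
  have a: "a > 0" "a * a = 3 * real d" using False by (simp_all add: a_def)
  have "2 ^ d * sqrt (real d / 3) = 2 ^ d * (a / 3)"
    by (simp add: a_def real_sqrt_divide real_sqrt_mult field_simps)
  also have "\<dots> \<le> 2 ^ d * ((3 * real d / a - (3 * real d ^ 2 - 2 * real d) / a ^ 3) / 2)"
  proof (rule mult_left_mono)
    have "3 * real d / a = a" using a by (simp add: field_simps)
    moreover have "(3 * real d ^ 2 - 2 * real d) / a ^ 3 \<le> 3 * real d ^ 2 / a ^ 3"
      using a by (intro divide_right_mono) auto
    moreover have "3 * real d ^ 2 / a ^ 3 = a / 3"
    proof -
      have "9 * real d ^ 2 = a ^ 3 * a"
        using a(2) by (simp add: power2_eq_square power3_eq_cube algebra_simps)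
      then show ?thesis using a by (simp add: field_simps)
    qed
    moreover have "a / 3 \<le> (p - q) / 2" if "p = a" "q \<le> r" "r = a / 3" for p q r
      using that by simp
    ultimately show "a / 3 \<le> (3 * real d / a - (3 * real d ^ 2 - 2 * real d) / a ^ 3) / 2" by metis
  qed simp
  also have "\<dots> = (\<Sum>N = 2 ^ d..<2 ^ Suc d. (3 * (walk x d N)\<^sup>2 / a - (walk x d N) ^ 4 / a ^ 3) / 2)"
    using walk_moments[OF x]
    by (simp add: sum_subtractf diff_divide_distrib right_diff_distrib
        flip: sum_divide_distrib sum_distrib_left)
  also have "\<dots> \<le> (\<Sum>N = 2 ^ d..<2 ^ Suc d. \<bar>walk x d N\<bar>)"
    by (intro sum_mono abs_ge_quartic a)
  finally show ?thesis .
qed (simp add: sum_nonneg)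

subsection \<open>Discrepancy and determinant lower bound\<close>

lemma submatrix_mat:
  assumes "I \<subseteq> {..<m}" "J \<subseteq> {..<n}"
  shows "submatrix (mat m n f) I J = mat (card I) (card J) (\<lambda>(i, j). f (pick I i, pick J j))"
proof -
  have dims: "{i. i < m \<and> i \<in> I} = I" "{j. j < n \<and> j \<in> J} = J" using assms by auto
  have "pick I i < m" if "i < card I" for i
    using pick_in_set_le[OF that] assms by auto
  moreover have "pick J j < n" if "j < card J" for j
    using pick_in_set_le[OF that] assms by auto
  ultimately show ?thesis
    unfolding submatrix_def by (intro eq_matI) (auto simp: dims)
qed

lemma submatrix_full: "submatrix A {..<dim_row A} {..<dim_col A} = A"
proof (rule eq_matI)
  show "dim_row (submatrix A {..<dim_row A} {..<dim_col A}) = dim_row A"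
    "dim_col (submatrix A {..<dim_row A} {..<dim_col A}) = dim_col A"
    by (simp_all add: dim_submatrix)
  fix i j assume ij: "i < dim_row A" "j < dim_col A"
  then have "{a\<in>{..<dim_row A}. a < i} = {..<i}" "{a\<in>{..<dim_col A}. a < j} = {..<j}" by auto
  then show "submatrix A {..<dim_row A} {..<dim_col A} $$ (i, j) = A $$ (i, j)"
    using submatrix_index_card[of i A j "{..<dim_row A}" "{..<dim_col A}"] ij by simp
qed

lemma submatrix_singleton:
  assumes "i < dim_row A" "j < dim_col A"
  shows "submatrix A {i} {j} = mat 1 1 (\<lambda>_. A $$ (i, j))"
proof -
  have sets: "{a. a < dim_row A \<and> a \<in> {i}} = {i}" "{a. a < dim_col A \<and> a \<in> {j}} = {j}"
    "{a\<in>{i}. a < i} = {}" "{a\<in>{j}. a < j} = {}"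
    using assms by auto
  then have "submatrix A {i} {j} $$ (0, 0) = A $$ (i, j)"
    using submatrix_index_card[of i A j "{i}" "{j}"] assms by (simp only: card.empty singletonI)
  moreover have "dim_row (submatrix A {i} {j}) = 1" "dim_col (submatrix A {i} {j}) = 1"
    by (simp_all only: dim_submatrix sets) simp_all
  ultimately show ?thesis by (intro eq_matI) auto
qed

lemma detlb_le:
  assumes "0 < dim_row A" "0 < dim_col A" "0 \<le> C"
    and le: "\<And>I J s. I \<subseteq> {..<dim_row A} \<Longrightarrow> J \<subseteq> {..<dim_col A} \<Longrightarrow> card I = s \<Longrightarrow> card J = s \<Longrightarrow>
      \<bar>det (submatrix A I J)\<bar> \<le> C ^ s"
  shows "detlb A \<le> C"
  unfolding detlb_def
proof (rule Max.boundedI[OF finite_detlb_set])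
  have "root 1 \<bar>det (submatrix A {0} {0})\<bar> \<in> {root k \<bar>det (submatrix A I J)\<bar> | k I J.
     1 \<le> k \<and> k \<le> min (dim_row A) (dim_col A) \<and>
     I \<subseteq> {..<dim_row A} \<and> card I = k \<and> J \<subseteq> {..<dim_col A} \<and> card J = k}"
    using assms(1,2) by (intro CollectI exI[of _ 1] exI[of _ "{0}"]) auto
  then show "{root k \<bar>det (submatrix A I J)\<bar> | k I J.
     1 \<le> k \<and> k \<le> min (dim_row A) (dim_col A) \<and>
     I \<subseteq> {..<dim_row A} \<and> card I = k \<and> J \<subseteq> {..<dim_col A} \<and> card J = k} \<noteq> {}" by blast
  fix y assume "y \<in> {root k \<bar>det (submatrix A I J)\<bar> | k I J.
     1 \<le> k \<and> k \<le> min (dim_row A) (dim_col A) \<and>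
     I \<subseteq> {..<dim_row A} \<and> card I = k \<and> J \<subseteq> {..<dim_col A} \<and> card J = k}"
  then obtain k I J where y: "y = root k \<bar>det (submatrix A I J)\<bar>" and k: "1 \<le> k"
    and IJ: "I \<subseteq> {..<dim_row A}" "card I = k" "J \<subseteq> {..<dim_col A}" "card J = k" by blast
  have "y \<le> root k (C ^ k)"
    unfolding y using k le[OF IJ(1,3,2,4)] by (intro real_root_le_mono) auto
  also have "\<dots> = C" using k assms(3) by (simp add: real_root_power_cancel)
  finally show "y \<le> C" .
qed

lemma detlb_ge_entry:
  assumes "i < dim_row A" "j < dim_col A"
  shows "\<bar>A $$ (i, j)\<bar> \<le> detlb A"
proof -
  have "det (submatrix A {i} {j}) = A $$ (i, j)"
    unfolding submatrix_singleton[OF assms] by (subst det_single) auto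
  then have "\<bar>A $$ (i, j)\<bar> = root 1 \<bar>det (submatrix A {i} {j})\<bar>" by simp
  moreover have "\<dots> \<le> detlb A"
    unfolding detlb_def using assms
    by (intro Max_ge[OF finite_detlb_set] CollectI exI[of _ 1] exI[of _ "{i}"] exI[of _ "{j}"]) auto
  ultimately show ?thesis by simp
qed

lemma herdisc_ge_disc:
  assumes "I \<subseteq> {..<dim_row A}" "I \<noteq> {}" "J \<subseteq> {..<dim_col A}" "J \<noteq> {}"
  shows "disc (submatrix A I J) \<le> herdisc A"
  unfolding herdisc_def using assms by (intro Max_ge[OF finite_herdisc_set]) blast

lemma linf_norm_ge: "i < dim_vec v \<Longrightarrow> \<bar>v $ i\<bar> \<le> linf_norm v"
  unfolding linf_norm_def by (intro Max_ge) auto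

lemma disc_ge:
  assumes "\<And>x. x \<in> sign_vecs (dim_col A) \<Longrightarrow> L \<le> linf_norm (A *\<^sub>v x)"
  shows "L \<le> disc A"
proof -
  have "{linf_norm (A *\<^sub>v x) | x. x \<in> sign_vecs (dim_col A)} =
      (\<lambda>x. linf_norm (A *\<^sub>v x)) ` sign_vecs (dim_col A)" by blast
  then show ?thesis
    unfolding disc_def using assms
    by (intro Min.boundedI) (auto simp: finite_sign_vecs sign_vecs_nonempty)
qed

lemma herdisc_ge_entry:
  assumes ij: "i < dim_row A" "j < dim_col A"
  shows "\<bar>A $$ (i, j)\<bar> \<le> herdisc A"
proof -
  let ?B = "submatrix A {i} {j}"
  have dim: "dim_row ?B = 1" "dim_col ?B = 1" and B: "?B $$ (0, 0) = A $$ (i, j)"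
    by (simp_all add: submatrix_singleton[OF ij])
  have "\<bar>A $$ (i, j)\<bar> \<le> disc ?B"
  proof (rule disc_ge)
    fix x assume "x \<in> sign_vecs (dim_col ?B)"
    then have x: "dim_vec x = 1" "x $ 0 = -1 \<or> x $ 0 = 1" by (auto simp: dim sign_vecs_def)
    have "(?B *\<^sub>v x) $ 0 = A $$ (i, j) * x $ 0"
      using x dim B by (simp add: scalar_prod_def)
    then show "\<bar>A $$ (i, j)\<bar> \<le> linf_norm (?B *\<^sub>v x)"
      using linf_norm_ge[of 0 "?B *\<^sub>v x"] x dim by auto
  qed
  also have "\<dots> \<le> herdisc A" using ij by (intro herdisc_ge_disc) auto
  finally show ?thesis .
qed

subsection \<open>The tree matrix\<close>

text \<open>
  A row encodes a set \<open>T \<subseteq> {..<k}\<close>, a leaf \<open>N\<close> of depth \<open>d\<close> and a direction \<open>b\<close> as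
  \<open>r = 2 ^ Suc d * set_encode T + 2 * (N - 2 ^ d) + b\<close>; a column encodes a copy \<open>j < k\<close> of the tree and
  an inner node \<open>v\<close> as \<open>c = j * 2 ^ d + v\<close>. The entry is \<open>1\<close> iff \<open>j \<in> T\<close> and the path from the root to
  \<open>N\<close> leaves \<open>v\<close> in direction \<open>b\<close>, with both directions allowed for \<open>v = 0\<close>. Surplus columns
  vanish, and surplus rows repeat earlier ones.
\<close>

definition tree_mat :: "nat \<Rightarrow> nat \<Rightarrow> nat \<Rightarrow> nat \<Rightarrow> real mat" where
  "tree_mat m n k d = mat m n (\<lambda>(r, c). of_bool
     (c div 2 ^ d \<in> {j. j < k \<and> j \<in> set_decode (r div 2 ^ Suc d)} \<and>
      2 ^ d + r div 2 mod 2 ^ d \<in> {N. ancestor (2 * (c mod 2 ^ d) + of_bool (odd r)) N}))"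

lemma detlb_tree_mat_le:
  assumes "0 < m" "0 < n"
  shows "detlb (tree_mat m n k d) \<le> 2 * sqrt (real k)"
proof (rule detlb_le)
  fix I J s
  assume "I \<subseteq> {..<dim_row (tree_mat m n k d)}" "J \<subseteq> {..<dim_col (tree_mat m n k d)}"
    and s: "card I = s" "card J = s"
  then have IJ: "I \<subseteq> {..<m}" "J \<subseteq> {..<n}" by (auto simp: tree_mat_def)
  have fin: "finite {j. j < k \<and> j \<in> X} \<and> card {j. j < k \<and> j \<in> X} \<le> k" for X :: "nat set"
    using card_mono[of "{..<k}" "{j. j < k \<and> j \<in> X}"] by auto
  \<comment> \<open>The label of a column is its copy of the tree, and its two sets are the subtrees
    below the left and right child of its node; a row tests the point given by its leaf.\<close>
  have "\<bar>det (mat s s (\<lambda>(r, c). of_bool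
      (pick J c div 2 ^ d \<in> {j. j < k \<and> j \<in> set_decode (pick I r div 2 ^ Suc d)} \<and>
      2 ^ d + pick I r div 2 mod 2 ^ d \<in>
        {N. ancestor (2 * (pick J c mod 2 ^ d) + of_bool (odd (pick I r))) N}) :: real))\<bar>
      \<le> (2 * sqrt (real k)) ^ s"
    by (rule det_two_laminar_le[where V = "\<lambda>b c. {N. ancestor (2 * (pick J c mod 2 ^ d) + of_bool b) N}"
          and \<beta> = "\<lambda>r. odd (pick I r)"]) (rule fin, rule laminar_ancestor)
  then show "\<bar>det (submatrix (tree_mat m n k d) I J)\<bar> \<le> (2 * sqrt (real k)) ^ s"
    unfolding tree_mat_def submatrix_mat[OF IJ] s by (simp only: prod.case)
qed (use assms in \<open>auto simp: tree_mat_def\<close>)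

lemma sum_lessThan_mult:
  fixes g :: "nat \<Rightarrow> 'a :: comm_monoid_add"
  shows "(\<Sum>c<k * p. g c) = (\<Sum>j<k. \<Sum>v<p. g (j * p + v))"
proof -
  have "sum g {j * p..<j * p + p} = (\<Sum>v<p. g (j * p + v))" for j
    by (simp add: sum.atLeastLessThan_shift_0[of g "j * p"] atLeast0LessThan)
  then show ?thesis by (simp flip: sum.nat_group)
qed

lemma set_encode_less:
  assumes "T \<subseteq> {..<k}"
  shows "set_encode T < 2 ^ k"
proof -
  have "set_encode T \<le> (\<Sum>j<k. 2 ^ j)"
    unfolding set_encode_def using assms by (intro sum_mono2) auto
  also have "\<dots> < (2::nat) ^ k" by (induction k) auto
  finally show ?thesis .
qed

text \<open>The nonnegative terms and the negative terms are two subsets without cancellation. This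
  is what the rows for all subsets \<open>T\<close> of the copies provide for.\<close>

lemma sum_abs_le_two_subset_sums:
  fixes t :: "'a \<Rightarrow> real"
  assumes "finite A" and le: "\<And>T. T \<subseteq> A \<Longrightarrow> \<bar>\<Sum>j\<in>T. t j\<bar> \<le> M"
  shows "(\<Sum>j\<in>A. \<bar>t j\<bar>) \<le> 2 * M"
proof -
  have "(\<Sum>j\<in>A. \<bar>t j\<bar>) = (\<Sum>j\<in>{j\<in>A. 0 \<le> t j}. t j) - (\<Sum>j\<in>{j\<in>A. t j < 0}. t j)"
  proof -
    have "(\<Sum>j\<in>A. \<bar>t j\<bar>) = (\<Sum>j\<in>{j\<in>A. 0 \<le> t j}. \<bar>t j\<bar>) + (\<Sum>j\<in>{j\<in>A. t j < 0}. \<bar>t j\<bar>)"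
      using assms(1) by (subst sum.union_disjoint[symmetric]) (auto intro!: sum.cong)
    then show ?thesis by (simp add: sum_negf)
  qed
  moreover have "\<bar>\<Sum>j\<in>{j\<in>A. 0 \<le> t j}. t j\<bar> \<le> M" "\<bar>\<Sum>j\<in>{j\<in>A. t j < 0}. t j\<bar> \<le> M"
    by (auto intro: le)
  ultimately show ?thesis by linarith
qed

lemma disc_tree_mat_ge:
  assumes cols: "k * 2 ^ d \<le> n" and rows: "2 ^ k * 2 ^ Suc d \<le> m"
  shows "real k * sqrt (real d / 3) / 4 \<le> disc (tree_mat m n k d)"
proof (rule disc_ge)
  let ?A = "tree_mat m n k d"
  fix x assume "x \<in> sign_vecs (dim_col ?A)"
  then have x: "dim_vec x = n" "\<And>c. c < n \<Longrightarrow> x $ c \<in> {-1, 1}"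
    by (auto simp: sign_vecs_def tree_mat_def)
  define M where "M = linf_norm (?A *\<^sub>v x)"
  \<comment> \<open>The contribution of copy \<open>j\<close> to a row with leaf \<open>N\<close>
    and direction \<open>b\<close>; the walk in that copy is
    \<open>t False N j - t True N j\<close>.\<close>
  define t where "t b N j = (\<Sum>v<2 ^ d. of_bool (ancestor (2 * v + of_bool b) N) * x $ (j * 2 ^ d + v))"
    for b N j
  have entry: "\<bar>\<Sum>j\<in>T. t b N j\<bar> \<le> M"
    if T: "T \<subseteq> {..<k}" and N: "N \<in> {2 ^ d..<2 ^ Suc d}" for T b N
  proof -
    define r where "r = 2 * (2 ^ d * set_encode T + (N - 2 ^ d)) + of_bool b"
    have half: "r div 2 = 2 ^ d * set_encode T + (N - 2 ^ d)" and odd: "odd r = b"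
      by (auto simp: r_def)
    have Nd: "N - 2 ^ d < 2 ^ d" using N by auto
    have leaf: "2 ^ d + r div 2 mod 2 ^ d = N"
      unfolding half mod_mult_self4 using Nd N by simp
    have "r div 2 ^ Suc d = r div 2 div 2 ^ d" by (simp add: div_mult2_eq)
    also have "\<dots> = set_encode T" using Nd by (simp add: half)
    finally have "set_decode (r div 2 ^ Suc d) = T"
      using T finite_subset[OF T] by simp
    note row = leaf odd this
    have "r < 2 * (2 ^ d * set_encode T + 2 ^ d)" using Nd by (auto simp: r_def)
    also have "\<dots> = (set_encode T + 1) * 2 ^ Suc d" by (simp add: algebra_simps)
    also have "\<dots> \<le> 2 ^ k * 2 ^ Suc d"
      using set_encode_less[OF T] by (intro mult_right_mono) auto
    finally have r: "r < m" using rows by simp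
    have "(?A *\<^sub>v x) $ r = (\<Sum>c<n. ?A $$ (r, c) * x $ c)"
      using r x(1) by (simp add: tree_mat_def scalar_prod_def atLeast0LessThan)
    also have "\<dots> = (\<Sum>c<n. of_bool (c div 2 ^ d < k \<and> c div 2 ^ d \<in> T) *
        (of_bool (ancestor (2 * (c mod 2 ^ d) + of_bool b) N) * x $ c))"
      using r by (intro sum.cong) (auto simp: tree_mat_def row simp del: power_Suc)
    also have "\<dots> = (\<Sum>c<k * 2 ^ d. of_bool (c div 2 ^ d \<in> T) *
        (of_bool (ancestor (2 * (c mod 2 ^ d) + of_bool b) N) * x $ c))"
      using cols by (intro sum.mono_neutral_cong_right)
        (auto simp: div_less_iff_less_mult less_mult_imp_div_less)
    also have "\<dots> = (\<Sum>j<k. of_bool (j \<in> T) * t b N j)"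
      unfolding sum_lessThan_mult t_def sum_distrib_left by (intro sum.cong) auto
    also have "\<dots> = (\<Sum>j\<in>T. t b N j)"
      using T by (intro sum.mono_neutral_cong_right) auto
    finally show ?thesis
      using linf_norm_ge[of r "?A *\<^sub>v x"] r by (simp add: M_def tree_mat_def)
  qed
  have "real k * (2 ^ d * sqrt (real d / 3)) =
      (\<Sum>j<k. 2 ^ d * sqrt (real d / 3))" by simp
  also have "\<dots> \<le> (\<Sum>j<k. \<Sum>N = 2 ^ d..<2 ^ Suc d. \<bar>walk (\<lambda>v. x $ (j * 2 ^ d + v)) d N\<bar>)"
  proof (intro sum_mono walk_abs_ge x(2))
    fix j v assume "j \<in> {..<k}" "v < (2::nat) ^ d"
    then have "j * 2 ^ d + v < Suc j * 2 ^ d" "Suc j * 2 ^ d \<le> k * 2 ^ d"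
      by (simp, intro mult_le_mono1) simp
    then show "j * 2 ^ d + v < n" using cols by linarith
  qed
  also have "\<dots> = (\<Sum>N = 2 ^ d..<2 ^ Suc d. \<Sum>j<k. \<bar>t False N j - t True N j\<bar>)"
    by (subst sum.swap)
      (simp add: walk_def t_def left_diff_distrib sum_subtractf del: power_Suc)
  also have "\<dots> \<le> (\<Sum>N = 2 ^ d..<2 ^ Suc d. \<Sum>j<k. \<bar>t False N j\<bar> + \<bar>t True N j\<bar>)"
    by (intro sum_mono abs_triangle_ineq4)
  \<comment> \<open>The 4 is one factor 2 for the two directions and one for splitting the copies by
    sign.\<close>
  also have "\<dots> \<le> (\<Sum>N = (2::nat) ^ d..<2 ^ Suc d. 4 * M)"
  proof (intro sum_mono)
    fix N assume "N \<in> {2 ^ d..<(2::nat) ^ Suc d}"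
    then have "(\<Sum>j<k. \<bar>t b N j\<bar>) \<le> 2 * M" for b
      by (intro sum_abs_le_two_subset_sums entry) auto
    from this[of False] this[of True]
    show "(\<Sum>j<k. \<bar>t False N j\<bar> + \<bar>t True N j\<bar>) \<le> 4 * M" by (simp add: sum.distrib)
  qed
  also have "\<dots> = 2 ^ d * (4 * M)" by simp
  finally have "2 ^ d * (real k * sqrt (real d / 3)) \<le> 2 ^ d * (4 * M)" by (simp add: mult_ac)
  then show "real k * sqrt (real d / 3) / 4 \<le> linf_norm (?A *\<^sub>v x)" by (simp add: M_def)
qed

lemma herdisc_over_detlb_tree_mat:
  assumes k: "0 < k" and cols: "k * 2 ^ d \<le> n" and rows: "2 ^ k * 2 ^ Suc d \<le> m"
  shows "sqrt (real k * real d / 192) \<le> herdisc (tree_mat m n k d) / detlb (tree_mat m n k d)"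
proof -
  let ?A = "tree_mat m n k d"
  have dims: "dim_row ?A = m" "dim_col ?A = n" by (simp_all add: tree_mat_def)
  have "(2::nat) ^ 1 \<le> 2 ^ k" using k by (intro power_increasing) auto
  then have "2 * 2 ^ Suc d \<le> (2::nat) ^ k * 2 ^ Suc d" by (intro mult_right_mono) auto
  moreover have "(2::nat) ^ Suc d < 2 * 2 ^ Suc d" by simp
  ultimately have r: "2 ^ Suc d < m" using rows by linarith
  have "0 < k * (2::nat) ^ d" using k by simp
  then have n: "0 < n" using cols by linarith
  have "set_decode 1 = {0}"
    using set_encode_inverse[of "{0}"] by (simp add: set_encode_def)
  \<comment> \<open>This row encodes \<open>T = {0}\<close>, the first leaf and the left direction;
    column 0 is the node 0 of copy 0. A single entry 1 keeps \<open>detlb\<close> away from 0, so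
    the quotient can be bounded.\<close>
  then have "?A $$ (2 ^ Suc d, 0) = 1"
    using r n k by (simp add: tree_mat_def ancestor_0 del: power_Suc)
  then have pos: "1 \<le> detlb ?A"
    using detlb_ge_entry[of "2 ^ Suc d" ?A 0] r n by (simp add: dims)
  have "real k * sqrt (real d / 3) / 4 \<le> disc ?A"
    by (rule disc_tree_mat_ge[OF cols rows])
  also have "\<dots> \<le> herdisc ?A"
    using herdisc_ge_disc[of "{..<m}" ?A "{..<n}"] submatrix_full[of ?A] r n
    by (auto simp: dims lessThan_empty_iff)
  finally have her: "real k * sqrt (real d / 3) / 4 \<le> herdisc ?A" .
  have her0: "0 \<le> herdisc ?A" by (rule order_trans[OF _ her]) simp
  \<comment> \<open>Here \<open>192 = 3 * 8 ^ 2\<close>: the 3 comes from the walk, and 8 is the 4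
    of the discrepancy bound times the 2 of the determinant bound.\<close>
  have "sqrt (real k * real d / 192) = sqrt (real k) * sqrt (real d / 3) / sqrt 64"
  proof -
    have "real k * real d / 192 = real k * (real d / 3) / 64" by simp
    then show ?thesis by (simp only: real_sqrt_mult real_sqrt_divide)
  qed
  also have "sqrt 64 = (8 :: real)" by (rule real_sqrt_unique) auto
  also have "sqrt (real k) * sqrt (real d / 3) / 8 = (real k * sqrt (real d / 3) / 4) / (2 * sqrt (real k))"
  proof -
    have "real k = sqrt (real k) * sqrt (real k)" by simp
    then show ?thesis using k by (simp add: field_simps)
  qed
  also have "\<dots> \<le> herdisc ?A / detlb ?A"
    using her pos detlb_tree_mat_le[of m n k d] r n her0 by (intro frac_le) auto
  finally show ?thesis .
qed

subsection \<open>The gap\<close>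

lemma floor_ge_half: "1 \<le> y \<Longrightarrow> y / 2 \<le> real (nat \<lfloor>y\<rfloor>)" for y :: real
proof -
  assume "1 \<le> y"
  then have "1 \<le> \<lfloor>y\<rfloor>" by simp
  then have "1 \<le> real_of_int \<lfloor>y\<rfloor>" by linarith
  moreover have "y < of_int \<lfloor>y\<rfloor> + 1" by linarith
  ultimately have "y / 2 \<le> of_int \<lfloor>y\<rfloor>" by linarith
  then show ?thesis using \<open>1 \<le> \<lfloor>y\<rfloor>\<close> by simp
qed

text \<open>Serves the small \<open>n\<close>. The determinants are at most 1 by the laminar bound
  with one label and all column sets equal.\<close>

lemma ratio_all_ones:
  assumes "0 < m" "0 < n"
  shows "1 \<le> herdisc (mat m n (\<lambda>_. 1)) / detlb (mat m n (\<lambda>_. 1))"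
proof -
  let ?A = "mat m n (\<lambda>_. 1) :: real mat"
  have "detlb ?A \<le> 1"
  proof (rule detlb_le)
    fix I J s
    assume "I \<subseteq> {..<dim_row ?A}" "J \<subseteq> {..<dim_col ?A}" and s: "card I = s" "card J = s"
    then have IJ: "I \<subseteq> {..<m}" "J \<subseteq> {..<n}" by auto
    have "\<bar>det (mat s s (\<lambda>(r, c). of_bool (0 \<in> {0::nat} \<and> 0 \<in> {0::nat}) :: real))\<bar> \<le> sqrt (real 1) ^ s"
      by (rule det_laminar_le[where l = "\<lambda>_. 0"]) auto
    moreover have "submatrix ?A I J = mat s s (\<lambda>(r, c). of_bool (0 \<in> {0::nat} \<and> 0 \<in> {0::nat}))"
      unfolding submatrix_mat[OF IJ] s by (intro eq_matI) auto
    ultimately show "\<bar>det (submatrix ?A I J)\<bar> \<le> 1 ^ s" by simp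
  qed (use assms in auto)
  moreover have "1 \<le> detlb ?A" using detlb_ge_entry[of 0 ?A 0] assms by simp
  moreover have "1 \<le> herdisc ?A" using herdisc_ge_entry[of 0 ?A 0] assms by simp
  ultimately show ?thesis by simp
qed

text \<open>The columns fit because \<open>k \<le> log 2 m \<le> n powr (1 - \<epsilon>)\<close> and
  \<open>2 ^ d \<le> n powr \<epsilon>\<close>. The rows fit because \<open>k\<close>,
  \<open>d\<close> and 1 are at most a quarter, a half and a quarter of \<open>log 2 m\<close>. The
  lower bounds on \<open>n\<close> make both rounded quantities at least 1, so rounding down costs
  at most a factor 2.\<close>

lemma parameter_choice:
  fixes m n :: nat and \<epsilon> :: real
  assumes \<epsilon>: "0 < \<epsilon>" "\<epsilon> < 1"
    and mn: "n \<le> m" "real m \<le> 2 powr (real n powr (1 - \<epsilon>))"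
    and n: "16 \<le> n" "2 powr (2 / \<epsilon>) \<le> real n"
  obtains k d where "0 < k" "k * 2 ^ d \<le> n" "2 ^ k * 2 ^ Suc d \<le> m"
    "log 2 m / 8 \<le> real k" "\<epsilon> * log 2 n / 4 \<le> real d"
proof -
  define a where "a = log 2 (real m)"
  define b where "b = log 2 (real n)"
  define k where "k = nat \<lfloor>a / 4\<rfloor>"
  define d where "d = nat \<lfloor>\<epsilon> * b / 2\<rfloor>"
  have ma: "2 powr a = real m" and nb: "2 powr b = real n"
    using mn n by (simp_all add: a_def b_def)
  have "2 powr 4 \<le> real n" using n by simp
  then have b4: "4 \<le> b" using n unfolding b_def by (subst le_log_iff) auto
  have ab: "b \<le> a" unfolding a_def b_def using mn n by simp
  have "2 / \<epsilon> \<le> b" using n unfolding b_def by (subst le_log_iff) auto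
  then have eb: "1 \<le> \<epsilon> * b / 2" using \<epsilon> by (simp add: field_simps)
  have k_lower: "a / 8 \<le> real k"
    using floor_ge_half[of "a / 4"] ab b4 by (simp add: k_def)
  have d_lower: "\<epsilon> * b / 4 \<le> real d"
    using floor_ge_half[OF eb] by (simp add: d_def)
  have k_upper: "real k \<le> a / 4" unfolding k_def using ab b4 by linarith
  have d_upper: "real d \<le> \<epsilon> * b / 2" unfolding d_def using eb by linarith
  have eb_le: "\<epsilon> * b \<le> 1 * b" using \<epsilon> b4 by (intro mult_right_mono) auto
  have "real (k * 2 ^ d) = real k * 2 powr real d" by (simp add: powr_realpow)
  also have "\<dots> \<le> real n powr (1 - \<epsilon>) * real n powr \<epsilon>"
  proof (intro mult_mono)
    have "a \<le> real n powr (1 - \<epsilon>)"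
      unfolding a_def using mn n by (subst log_le_iff) auto
    then show "real k \<le> real n powr (1 - \<epsilon>)" using k_upper ab b4 by linarith
    have "real d \<le> b * \<epsilon>" using d_upper eb by (simp add: mult.commute)
    then have "2 powr real d \<le> 2 powr (b * \<epsilon>)" by simp
    also have "\<dots> = real n powr \<epsilon>" by (simp only: powr_powr[symmetric] nb)
    finally show "2 powr real d \<le> real n powr \<epsilon>" .
  qed auto
  also have "\<dots> = real n" using n by (simp flip: powr_add)
  finally have cols: "k * 2 ^ d \<le> n" by (simp only: of_nat_le_iff)
  have "real (2 ^ k * 2 ^ Suc d) = 2 powr (real k + (real d + 1))"
    by (simp add: powr_add powr_realpow)
  also have "\<dots> \<le> 2 powr a"
  proof (rule powr_mono)
    show "real k + (real d + 1) \<le> a" using k_upper d_upper eb_le ab b4 by linarith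
  qed simp
  finally have rows: "2 ^ k * 2 ^ Suc d \<le> m" unfolding ma by (simp only: of_nat_le_iff)
  have "0 < k" using k_lower ab b4 by (cases "k = 0") auto
  then show thesis using that[OF _ cols rows] k_lower d_lower by (simp add: a_def b_def)
qed

theorem theorem1:
  fixes \<epsilon> :: real
  assumes "0 < \<epsilon>" and "\<epsilon> < 1"
  shows "\<exists>c::real. c > 0 \<and>
    (\<forall>(n::nat) (m::nat). 2 \<le> n \<and> n \<le> m \<and> real m \<le> 2 powr (real n powr (1 - \<epsilon>)) \<longrightarrow>
      (\<exists>A :: real mat. A \<in> carrier_mat m n \<and> (\<forall>i<m. \<forall>j<n. A $$ (i, j) \<in> {0, 1}) \<and>
        herdisc A / detlb A \<ge> c * sqrt (ln (real m) * ln (real n))))"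
proof -
  define N where "N = max 16 (2 powr (2 / \<epsilon>))"
  \<comment> \<open>The first term handles \<open>n < N\<close>, where the square root is at most
    \<open>n\<close>; in the second, \<open>6144 = 8 * 4 * 192\<close> collects the losses in
    \<open>k\<close>, in \<open>d\<close> and in the ratio.\<close>
  define c where "c = min (1 / N) (sqrt (\<epsilon> / 6144))"
  have N: "0 < N" by (simp add: N_def)
  have c: "0 < c" using N assms by (simp add: c_def)
  moreover have "\<exists>A :: real mat. A \<in> carrier_mat m n \<and> (\<forall>i<m. \<forall>j<n. A $$ (i, j) \<in> {0, 1}) \<and>
      c * sqrt (ln (real m) * ln (real n)) \<le> herdisc A / detlb A"
    if n: "2 \<le> n" and nm: "n \<le> m" and m: "real m \<le> 2 powr (real n powr (1 - \<epsilon>))" for n m :: nat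
  proof (cases "N \<le> real n")
    case True
    then obtain k d where kd: "0 < k" "k * 2 ^ d \<le> n" "2 ^ k * 2 ^ Suc d \<le> m"
        "log 2 m / 8 \<le> real k" "\<epsilon> * log 2 n / 4 \<le> real d"
      using parameter_choice[OF assms nm m] by (auto simp: N_def)
    have ln_log: "0 \<le> ln x" "ln x \<le> log 2 x" if "1 \<le> x" for x :: real
    proof -
      show 0: "0 \<le> ln x" using that by simp
      have "ln x * ln 2 \<le> ln x * 1" using 0 ln_le_minus_one[of 2] by (intro mult_left_mono) auto
      then show "ln x \<le> log 2 x" by (simp add: log_def field_simps)
    qed
    have "c * sqrt (ln (real m) * ln (real n)) \<le> sqrt (\<epsilon> / 6144) * sqrt (ln (real m) * ln (real n))"
      using n nm by (intro mult_right_mono) (auto simp: c_def)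
    also have "\<dots> = sqrt ((ln (real m) / 8) * (\<epsilon> * ln (real n) / 4) / 192)"
      unfolding real_sqrt_mult[symmetric] by (simp add: field_simps)
    also have "\<dots> \<le> sqrt (real k * real d / 192)"
    proof (intro real_sqrt_le_mono divide_right_mono mult_mono)
      show "ln (real m) / 8 \<le> real k" using kd(4) ln_log(2)[of "real m"] n nm by simp
      have "\<epsilon> * ln (real n) \<le> \<epsilon> * log 2 (real n)"
        using ln_log(2)[of "real n"] n assms by (intro mult_left_mono) auto
      then show "\<epsilon> * ln (real n) / 4 \<le> real d" using kd(5) by simp
    qed (use n assms in auto)
    also have "\<dots> \<le> herdisc (tree_mat m n k d) / detlb (tree_mat m n k d)"
      by (rule herdisc_over_detlb_tree_mat[OF kd(1-3)])
    finally show ?thesis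
      by (intro exI[of _ "tree_mat m n k d"]) (auto simp: tree_mat_def)
  next
    case False
    have "real n powr (1 - \<epsilon>) \<le> real n powr 1" using assms n by (intro powr_mono) auto
    then have "2 powr (real n powr (1 - \<epsilon>)) \<le> 2 powr real n" using n by simp
    then have "real m \<le> 2 powr real n" using m by linarith
    then have "ln (real m) \<le> ln (2 powr real n)" using n nm by (intro ln_mono) auto
    also have "\<dots> = real n * ln 2" by (simp add: ln_powr)
    also have "\<dots> \<le> real n * 1" using ln_le_minus_one[of 2] by (intro mult_left_mono) auto
    finally have "ln (real m) * ln (real n) \<le> real n * real n"
      using n ln_le_minus_one[of "real n"] by (intro mult_mono) auto
    then have "sqrt (ln (real m) * ln (real n)) \<le> real n"
      by (intro real_le_lsqrt) (auto simp: power2_eq_square)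
    then have "c * sqrt (ln (real m) * ln (real n)) \<le> 1 / N * N"
      using False c N n nm by (intro mult_mono) (auto simp: c_def)
    also have "\<dots> = 1" using N by simp
    also have "\<dots> \<le> herdisc (mat m n (\<lambda>_. 1)) / detlb (mat m n (\<lambda>_. 1))"
      using n nm by (intro ratio_all_ones) auto
    finally show ?thesis by (intro exI[of _ "mat m n (\<lambda>_. 1)"]) auto
  qed
  ultimately show ?thesis by blast
qed

end
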